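(* Let $G$ be the straight linear 2-tree with $n=m+2\ge 3$ vertices, and let $j,k$ be integers with $1\le j<n$, $k\ge1$, $j+k\le n$. Then the number of spanning 2-forests of $G$ which separate vertices $j$ and $j+k$ equals \[ \sum_{i=1}^{k}\left[F_iF_{i+2j-2}-F_{i-1}F_{i+2j-3}\right]F_{2m-2i-2j+5} = F_{m+1}^2+F_k^2F_{m-2j-k+3}^2+\frac{F_{m+1}}{5}\left(F_{m-k}\left(kL_k-F_k\right)+F_{m-k+1}\left((k-5)F_{k+1}+(2k+2)F_{k}\right)\right). \]
   Context: The straight linear 2-tree on $n$ vertices is the graph with vertex set $\{1,\dots,n\}$ in which $\{i,j\}$ is an edge if and only if $0<|i-j|\le 2$. A spanning 2-forest is a spanning subgraph that is a forest with exactly two connected components; it separates $j$ and $j+k$ if these vertices lie in different components. $F_p$ are the Fibonacci numbers ($F_0=0,F_1=1,F_{p+1}=F_p+F_{p-1}$, extended to all integers by the recurrence, so $F_{-p}=(-1)^{p+1}F_p$), and $L_p=F_{p-1}+F_{p+1}$ are the Lucas numbers. *)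

theory Defs
  imports Complex_Main "HOL-Number_Theory.Fib"
begin

text \<open>Finite simple undirected graphs; an edge is the two-element set of its end vertices.\<close>

record 'a ugraph =
  verts :: "'a set"
  edges :: "'a set set"

definition simple_graph :: "'a ugraph \<Rightarrow> bool" where
  "simple_graph G \<longleftrightarrow> finite (verts G) \<and>
     (\<forall>e\<in>edges G. \<exists>u\<in>verts G. \<exists>v\<in>verts G. u \<noteq> v \<and> e = {u, v})"

definition spanning_subgraph :: "'a ugraph \<Rightarrow> 'a ugraph \<Rightarrow> bool" where
  "spanning_subgraph H G \<longleftrightarrow> simple_graph H \<and> verts H = verts G \<and> edges H \<subseteq> edges G"

definition walk :: "'a ugraph \<Rightarrow> 'a list \<Rightarrow> bool" where
  "walk G xs \<longleftrightarrow> xs \<noteq> [] \<and> set xs \<subseteq> verts G \<and> successively (\<lambda>u v. {u, v} \<in> edges G) xs"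

definition component :: "'a ugraph \<Rightarrow> 'a \<Rightarrow> 'a set" where
  "component G u = {v. \<exists>xs. walk G xs \<and> hd xs = u \<and> last xs = v}"

definition components :: "'a ugraph \<Rightarrow> 'a set set" where
  "components G = component G ` verts G"

text \<open>A cycle is given by the list of its vertices, the first one not being repeated at the end.\<close>

definition cycle :: "'a ugraph \<Rightarrow> 'a list \<Rightarrow> bool" where
  "cycle G xs \<longleftrightarrow> walk G xs \<and> distinct xs \<and> 3 \<le> length xs \<and> {last xs, hd xs} \<in> edges G"

definition forest :: "'a ugraph \<Rightarrow> bool" where
  "forest G \<longleftrightarrow> simple_graph G \<and> (\<nexists>xs. cycle G xs)"

definition spanning_2_forest :: "'a ugraph \<Rightarrow> 'a ugraph \<Rightarrow> bool" where
  "spanning_2_forest H G \<longleftrightarrow> spanning_subgraph H G \<and> forest H \<and> card (components H) = 2"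

definition separates :: "'a ugraph \<Rightarrow> 'a \<Rightarrow> 'a \<Rightarrow> bool" where
  "separates H u v \<longleftrightarrow> component H u \<noteq> component H v"

definition straight_linear_2_tree :: "int \<Rightarrow> int ugraph" where
  "straight_linear_2_tree n =
     \<lparr>verts = {1..n},
      edges = {{i, j} |i j. i \<in> {1..n} \<and> j \<in> {1..n} \<and> 0 < \<bar>i - j\<bar> \<and> \<bar>i - j\<bar> \<le> 2}\<rparr>"

lemma simple_graph_straight_linear_2_tree: "simple_graph (straight_linear_2_tree n)"
  unfolding simple_graph_def straight_linear_2_tree_def by fastforce

text \<open>
  Fibonacci numbers at integer indices. Lemma \<open>fibz_unique\<close> shows that this is the extension
  determined by the recurrence.
\<close>

definition fibz :: "int \<Rightarrow> int" where
  "fibz p = (if 0 \<le> p then int (fib (nat p)) else (-1) ^ (nat (- p) + 1) * int (fib (nat (- p))))"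

definition lucas :: "int \<Rightarrow> int" where
  "lucas p = fibz (p - 1) + fibz (p + 1)"

lemma fibz_of_nat [simp]: "fibz (int n) = int (fib n)"
  by (simp add: fibz_def)

lemma fibz_minus_of_nat: "fibz (- int n) = (-1) ^ (n + 1) * int (fib n)"
  by (cases "n = 0") (simp_all add: fibz_def)

lemma fibz_0 [simp]: "fibz 0 = 0"
  and fibz_1 [simp]: "fibz 1 = 1"
  by (simp_all add: fibz_def)

lemma fibz_rec: "fibz (p + 1) = fibz p + fibz (p - 1)"
proof -
  consider n where "p = int n + 1" | "p = 0" | n where "p = - int n - 1"
  proof (cases "p = 0")
    case False
    then show ?thesis
    proof (cases "p > 0")
      case True
      then have "p = int (nat (p - 1)) + 1" by simp
      then show ?thesis using that by blast
    next
      case f: False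
      then have "p = - int (nat (- p - 1)) - 1" using False by simp
      then show ?thesis using that by blast
    qed
  qed (use that in blast)
  then show ?thesis
  proof cases
    case (1 n)
    then have "p + 1 = int (Suc (Suc n))" "p = int (Suc n)" "p - 1 = int n" by simp_all
    then show ?thesis by (simp only: fibz_of_nat) simp
  next
    case 2
    then show ?thesis by (simp add: fibz_def)
  next
    case (3 n)
    then have "p + 1 = - int n" "p = - int (Suc n)" "p - 1 = - int (Suc (Suc n))" by simp_all
    then show ?thesis by (simp only: fibz_minus_of_nat) (simp add: algebra_simps)
  qed
qed

lemma fibz_unique:
  fixes f :: "int \<Rightarrow> int"
  assumes "f 0 = 0" and "f 1 = 1" and rec: "\<And>p. f (p + 1) = f p + f (p - 1)"
  shows "f = fibz"
proof
  fix p
  have "f p = fibz p \<and> f (p + 1) = fibz (p + 1)"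
  proof (induction p rule: int_induct [where k = 0])
    case base
    then show ?case using assms by simp
  next
    case (step1 i)
    then show ?case using rec [of "i + 1"] fibz_rec [of "i + 1"] by simp
  next
    case (step2 i)
    then show ?case using rec [of i] fibz_rec [of i] by simp
  qed
  then show "f p = fibz p" ..
qed

end

theory Submission
  imports Defs
begin

text \<open>
  Vertices are attached in increasing order. The new vertex \<open>p + 1\<close> has the neighbours
  \<open>p - 1\<close> and \<open>p\<close>: used as a leaf, it does not change the forest below it; joined to both, it
  acts as an edge between two vertices of different components, that is, it identifies them.
  Writing \<open>U p\<close> for the number of forests on \<open>{1..p}\<close> of the wanted kind and \<open>V p\<close> for the
  number of those which become so when \<open>p - 1\<close> and \<open>p\<close> are identified, this gives
  \<open>U (p + 1) = 2 U p + V p\<close> and \<open>V (p + 1) = U p + V p\<close>, both for spanning trees and for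
  2-forests separating \<open>j\<close> and \<open>w \<le> p\<close>.

  For \<open>w = p\<close> and \<open>w = p - 1\<close> the numbers \<open>V p\<close> agree. So, if \<open>D p\<close> is the difference of the two
  numbers \<open>U p\<close>, the counts at \<open>n\<close> for \<open>w = p\<close> and \<open>w = p - 1\<close> differ by
  \<open>fibz (2 * (n - p) + 1) * D p\<close>, which is a summand of the asserted sum: \<open>D (p + 1)\<close> is the
  number of spanning trees on \<open>{1..p}\<close> minus \<open>D p\<close>. The sum telescopes from \<open>w = j\<close>.
\<close>

section \<open>Acyclic edge sets and connectivity\<close>

definition conn :: "'a set set \<Rightarrow> 'a \<Rightarrow> 'a \<Rightarrow> bool" where
  "conn A = (\<lambda>u v. {u, v} \<in> A)\<^sup>*\<^sup>*"

text \<open>Every edge is a bridge. This form, in contrast to one with lists of vertices, allows a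
  simple rule for inserting an edge; a loop \<open>{u, u}\<close> is excluded too.\<close>

definition acyc :: "'a set set \<Rightarrow> bool" where
  "acyc A \<longleftrightarrow> (\<forall>u v. {u, v} \<in> A \<longrightarrow> \<not> conn (A - {{u, v}}) u v)"

text \<open>For an equivalence relation \<open>R\<close> this is the merging of the classes of
  \<open>a\<close> and \<open>b\<close>. It describes both the insertion of an edge and the
  identification of two vertices.\<close>

definition link :: "'a \<Rightarrow> 'a \<Rightarrow> ('a \<Rightarrow> 'a \<Rightarrow> bool) \<Rightarrow> 'a \<Rightarrow> 'a \<Rightarrow> bool" where
  "link a b R u v \<longleftrightarrow> R u v \<or> R u a \<and> R b v \<or> R u b \<and> R a v"

lemma conn_refl [simp]: "conn A u u"
  by (simp add: conn_def)

lemma conn_edge: "{u, v} \<in> A \<Longrightarrow> conn A u v"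
  by (auto simp: conn_def)

lemma conn_trans: "conn A u v \<Longrightarrow> conn A v w \<Longrightarrow> conn A u w"
  by (simp add: conn_def)

lemma conn_sym: "conn A u v \<Longrightarrow> conn A v u"
proof -
  have "symp (\<lambda>u v. {u, v} \<in> A)" by (auto intro!: sympI simp: insert_commute)
  then show "conn A u v \<Longrightarrow> conn A v u"
    unfolding conn_def by (meson symp_rtranclp sympD)
qed

lemma equivp_conn: "equivp (conn A)"
  by (intro equivpI reflpI sympI transpI) (blast intro: conn_sym conn_trans conn_refl)+

lemma conn_mono: "conn A u v \<Longrightarrow> A \<subseteq> B \<Longrightarrow> conn B u v"
  unfolding conn_def by (erule rtranclp_mono [THEN predicate2D, rotated]) auto

lemma conn_insert: "conn (insert {a, b} A) = link a b (conn A)"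
proof (intro ext iffI)
  fix u v
  assume "conn (insert {a, b} A) u v"
  then have "(\<lambda>u v. {u, v} \<in> insert {a, b} A)\<^sup>*\<^sup>* u v" by (simp add: conn_def)
  then show "link a b (conn A) u v"
  proof (induction rule: rtranclp_induct)
    case base
    then show ?case by (simp add: link_def)
  next
    case (step y z)
    consider "{y, z} \<in> A" | "y = a" "z = b" | "y = b" "z = a"
      using step.hyps(2) by (auto simp: doubleton_eq_iff)
    then show ?case
    proof cases
      case 1
      then show ?thesis
        using step.IH unfolding link_def by (blast intro: conn_edge conn_trans)
    qed (use step.IH in \<open>auto simp: link_def intro: conn_sym conn_trans\<close>)
  qed
next
  fix u v
  assume "link a b (conn A) u v"
  moreover have "conn (insert {a, b} A) a b" "conn (insert {a, b} A) b a"
    by (auto intro: conn_edge conn_sym)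
  moreover have "conn (insert {a, b} A) x y" if "conn A x y" for x y
    using that by (rule conn_mono) blast
  ultimately show "conn (insert {a, b} A) u v"
    unfolding link_def by (meson conn_trans)
qed

lemma conn_isolated:
  assumes "x \<notin> \<Union>A"
  shows "conn A x v \<longleftrightarrow> v = x"
proof
  assume "conn A x v"
  then show "v = x"
    unfolding conn_def by (cases rule: converse_rtranclpE) (use assms in auto)
qed simp

lemma acyc_empty: "acyc {}"
  by (simp add: acyc_def)

text \<open>The new edge is a bridge iff its ends were not connected before. An old edge
  \<open>{u, v}\<close> stays one: a detour from \<open>u\<close> to \<open>v\<close> through the
  new edge, closed up by \<open>{u, v}\<close>, would connect \<open>a\<close> with \<open>b\<close>
  inside \<open>A\<close>.\<close>

lemma acyc_insert:
  assumes "{a, b} \<notin> A"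
  shows "acyc (insert {a, b} A) \<longleftrightarrow> acyc A \<and> \<not> conn A a b"
proof
  assume *: "acyc (insert {a, b} A)"
  have "\<not> conn A a b"
    using * assms unfolding acyc_def by (metis Diff_insert_absorb insertI1)
  moreover have "acyc A"
    unfolding acyc_def
  proof (intro allI impI notI)
    fix u v
    assume "{u, v} \<in> A" "conn (A - {{u, v}}) u v"
    then show False
      using * conn_mono [of "A - {{u, v}}" u v "insert {a, b} A - {{u, v}}"]
      unfolding acyc_def by blast
  qed
  ultimately show "acyc A \<and> \<not> conn A a b" by blast
next
  assume *: "acyc A \<and> \<not> conn A a b"
  show "acyc (insert {a, b} A)"
    unfolding acyc_def
  proof (intro allI impI notI)
    fix u v
    assume uv: "{u, v} \<in> insert {a, b} A" and c: "conn (insert {a, b} A - {{u, v}}) u v"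
    show False
    proof (cases "{u, v} = {a, b}")
      case True
      then have "conn A u v" using c assms by simp
      then show False using True * conn_sym by (metis doubleton_eq_iff)
    next
      case False
      then have uvA: "{u, v} \<in> A" and "insert {a, b} A - {{u, v}} = insert {a, b} (A - {{u, v}})"
        using uv by auto
      then have "link a b (conn (A - {{u, v}})) u v" using c by (simp add: conn_insert)
      moreover have "\<not> conn (A - {{u, v}}) u v" using * uvA by (simp add: acyc_def)
      moreover have "conn A x y" if "conn (A - {{u, v}}) x y" for x y
        using that by (rule conn_mono) blast
      ultimately have "conn A u a \<and> conn A b v \<or> conn A u b \<and> conn A a v"
        unfolding link_def by blast
      then show False using * conn_edge [OF uvA] by (meson conn_sym conn_trans)
    qed
  qed
qed

section \<open>Walks, components and cycles in terms of \<open>conn\<close> and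
  \<open>acyc\<close>\<close>

lemma conn_distinct_path:
  assumes "conn A u v"
  shows "\<exists>xs. xs \<noteq> [] \<and> hd xs = u \<and> last xs = v \<and> distinct xs \<and>
    successively (\<lambda>x y. {x, y} \<in> A) xs \<and> set xs \<subseteq> {y. conn A u y}"
  using assms unfolding conn_def
proof (induction rule: rtranclp_induct)
  case base
  then show ?case by (intro exI [of _ "[u]"]) simp
next
  case (step y z)
  then obtain xs where xs: "xs \<noteq> []" "hd xs = u" "last xs = y" "distinct xs"
    "successively (\<lambda>x y. {x, y} \<in> A) xs" "set xs \<subseteq> {y. (\<lambda>u v. {u, v} \<in> A)\<^sup>*\<^sup>* u y}"
    by blast
  have uz: "(\<lambda>u v. {u, v} \<in> A)\<^sup>*\<^sup>* u z" using step.hyps by (rule rtranclp.rtrancl_into_rtrancl)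
  show ?case
  proof (cases "z \<in> set xs")
    case True
    \<comment> \<open>The path returns to one of its own vertices, so it is cut off there.\<close>
    then obtain as bs where "xs = as @ z # bs" by (meson split_list)
    then show ?thesis
      using xs by (intro exI [of _ "as @ [z]"])
        (auto simp: successively_append_iff successively_Cons hd_append split: if_splits)
  next
    case False
    then show ?thesis
      using xs uz step.hyps(2)
      by (intro exI [of _ "xs @ [z]"]) (auto simp: successively_append_iff)
  qed
qed

lemma successively_conn:
  "successively (\<lambda>x y. {x, y} \<in> A) xs \<Longrightarrow> xs \<noteq> [] \<Longrightarrow> conn A (hd xs) (last xs)"
proof (induction xs)
  case (Cons x xs)
  then show ?case
    by (cases "xs = []") (auto simp: successively_Cons intro: conn_edge conn_trans)
qed simp

lemma conn_in_verts:
  assumes "simple_graph H" "u \<in> verts H" "conn (edges H) u v"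
  shows "v \<in> verts H"
  using assms(3) unfolding conn_def
proof (induction rule: rtranclp_induct)
  case (step y z)
  then show ?case using assms(1) unfolding simple_graph_def by (metis doubleton_eq_iff)
qed (rule assms)

lemma component_eq_conn:
  assumes "simple_graph H" "u \<in> verts H"
  shows "component H u = {v. conn (edges H) u v}"
proof (intro equalityI subsetI)
  fix v
  assume "v \<in> component H u"
  then show "v \<in> {v. conn (edges H) u v}"
    unfolding component_def walk_def using successively_conn by fastforce
next
  fix v
  assume "v \<in> {v. conn (edges H) u v}"
  then show "v \<in> component H u"
    using conn_distinct_path [of "edges H" u v] conn_in_verts [OF assms]
    unfolding component_def walk_def by (auto 4 4)
qed

text \<open>A cycle is an edge together with a path between its ends which avoids that edge, so a
  cycle exists iff some edge is not a bridge.\<close>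

lemma forest_iff_acyc:
  assumes H: "simple_graph H"
  shows "forest H \<longleftrightarrow> acyc (edges H)"
proof
  assume f: "forest H"
  show "acyc (edges H)"
    unfolding acyc_def
  proof (intro allI impI notI)
    fix u v
    assume uv: "{u, v} \<in> edges H" and c: "conn (edges H - {{u, v}}) u v"
    obtain xs where xs: "xs \<noteq> []" "hd xs = u" "last xs = v" "distinct xs"
      "successively (\<lambda>x y. {x, y} \<in> edges H - {{u, v}}) xs"
      "set xs \<subseteq> {y. conn (edges H - {{u, v}}) u y}"
      using conn_distinct_path [OF c] by (elim exE conjE) (rule that)
    obtain a b where "a \<in> verts H" "b \<in> verts H" "a \<noteq> b" "{u, v} = {a, b}"
      using uv H unfolding simple_graph_def by meson
    then have "u \<noteq> v" "u \<in> verts H" by (auto simp: doubleton_eq_iff)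
    have "conn (edges H) u y" if "y \<in> set xs" for y
      using xs(6) that by (auto intro: conn_mono [OF _ Diff_subset])
    then have "set xs \<subseteq> verts H"
      using conn_in_verts [OF H \<open>u \<in> verts H\<close>] by auto
    moreover have "successively (\<lambda>x y. {x, y} \<in> edges H) xs"
      using xs(5) by (rule successively_mono) simp
    \<comment> \<open>One vertex is impossible because the ends differ, two because the path would
      then use the removed edge \<open>{u, v}\<close>.\<close>
    moreover have "3 \<le> length xs"
    proof -
      have "length xs \<noteq> 0" "length xs \<noteq> Suc 0" "length xs \<noteq> Suc (Suc 0)"
        using xs(1-5) \<open>u \<noteq> v\<close> by (auto simp: length_Suc_conv)
      then show ?thesis by linarith
    qed
    ultimately have "cycle H xs"
      using xs uv unfolding cycle_def walk_def by (simp add: insert_commute)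
    then show False using f by (auto simp: forest_def)
  qed
next
  assume a: "acyc (edges H)"
  have False if "cycle H xs" for xs
  proof -
    have len: "3 \<le> length xs" and e: "{last xs, hd xs} \<in> edges H" and d: "distinct xs"
      and s: "successively (\<lambda>x y. {x, y} \<in> edges H) xs"
      using that by (auto simp: cycle_def walk_def)
    have ne: "xs \<noteq> []" using len by auto
    have "successively (\<lambda>x y. {x, y} \<in> edges H - {{hd xs, last xs}}) xs"
      unfolding successively_conv_nth
    proof (intro allI impI)
      fix i
      assume i: "Suc i < length xs"
      \<comment> \<open>The closing edge joins positions \<open>0\<close> and
        \<open>length xs - 1\<close>, which are not consecutive in a list of length at least
        3.\<close>
      have "{xs ! i, xs ! Suc i} \<noteq> {xs ! 0, xs ! (length xs - 1)}"
      proof -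
        have "xs ! i = xs ! 0 \<longleftrightarrow> i = 0"
          "xs ! Suc i = xs ! (length xs - 1) \<longleftrightarrow> Suc i = length xs - 1"
          "xs ! i = xs ! (length xs - 1) \<longleftrightarrow> i = length xs - 1"
          "xs ! Suc i = xs ! 0 \<longleftrightarrow> Suc i = 0"
          using i len by (intro nth_eq_iff_index_eq [OF d]; linarith)+
        then show ?thesis
          unfolding doubleton_eq_iff using i len by linarith
      qed
      then show "{xs ! i, xs ! Suc i} \<in> edges H - {{hd xs, last xs}}"
        using s i ne by (simp add: hd_conv_nth last_conv_nth successively_conv_nth)
    qed
    then have "conn (edges H - {{hd xs, last xs}}) (hd xs) (last xs)"
      using ne by (rule successively_conn)
    moreover have "{hd xs, last xs} \<in> edges H" using e by (simp add: insert_commute)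
    ultimately show False using a unfolding acyc_def by blast
  qed
  then show "forest H" using H by (auto simp: forest_def)
qed

section \<open>Counting forests along the straight linear 2-tree\<close>

abbreviation E :: "int \<Rightarrow> int set set" where
  "E p \<equiv> edges (straight_linear_2_tree p)"

text \<open>The condition sees an edge set only through its connectivity relation, so a new vertex
  can be accounted for by applying \<open>link\<close> to that relation.\<close>

definition num :: "int \<Rightarrow> ((int \<Rightarrow> int \<Rightarrow> bool) \<Rightarrow> bool) \<Rightarrow> int" where
  "num p P = int (card {A. A \<subseteq> E p \<and> acyc A \<and> P (conn A)})"

text \<open>The properties of \<open>conn A\<close> for \<open>A\<close> within \<open>E p\<close>
  that the counting uses. As \<open>conn\<close> lives on all integers, vertices beyond
  \<open>p\<close> are isolated points.\<close>

definition equiv_upto :: "int \<Rightarrow> (int \<Rightarrow> int \<Rightarrow> bool) \<Rightarrow> bool" where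
  "equiv_upto p R \<longleftrightarrow> equivp R \<and> (\<forall>x>p. \<forall>v. R x v \<longleftrightarrow> v = x)"

definition tree :: "int \<Rightarrow> (int \<Rightarrow> int \<Rightarrow> bool) \<Rightarrow> bool" where
  "tree p R \<longleftrightarrow> (\<forall>u\<in>{1..p}. \<forall>v\<in>{1..p}. R u v)"

text \<open>Exactly two components, without counting them: those of \<open>j\<close> and
  \<open>w\<close> are different and cover everything.\<close>

definition sep :: "int \<Rightarrow> int \<Rightarrow> int \<Rightarrow> (int \<Rightarrow> int \<Rightarrow> bool) \<Rightarrow> bool" where
  "sep j w p R \<longleftrightarrow> \<not> R j w \<and> (\<forall>v\<in>{1..p}. R v j \<or> R v w)"

text \<open>Forests which satisfy \<open>Q\<close> once the two last vertices have been identified.\<close>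

definition glued :: "(int \<Rightarrow> (int \<Rightarrow> int \<Rightarrow> bool) \<Rightarrow> bool) \<Rightarrow> int \<Rightarrow> (int \<Rightarrow> int \<Rightarrow> bool) \<Rightarrow> bool" where
  "glued Q p R \<longleftrightarrow> \<not> R (p - 1) p \<and> Q p (link (p - 1) p R)"

text \<open>All that the recursion needs to know of \<open>tree\<close> and \<open>sep\<close>: an
  isolated new vertex is forbidden, and a new leaf changes nothing.\<close>

definition leaf_invariant :: "int \<Rightarrow> (int \<Rightarrow> (int \<Rightarrow> int \<Rightarrow> bool) \<Rightarrow> bool) \<Rightarrow> bool" where
  "leaf_invariant p Q \<longleftrightarrow> (\<forall>R. equiv_upto p R \<longrightarrow>
     \<not> Q (p + 1) R \<and> (\<forall>a\<in>{1..p}. Q (p + 1) (link a (p + 1) R) \<longleftrightarrow> Q p R))"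

lemma equiv_uptoD:
  assumes "equiv_upto p R"
  shows "R u u" "R u v \<Longrightarrow> R v u" "R u v \<Longrightarrow> R v w \<Longrightarrow> R u w"
    "p < x \<Longrightarrow> R x v \<longleftrightarrow> v = x" "p < x \<Longrightarrow> R v x \<longleftrightarrow> v = x"
  using assms unfolding equiv_upto_def
  by (auto dest: equivp_reflp equivp_symp equivp_transp)

lemma in_E_iff: "{a, b} \<in> E p \<longleftrightarrow> a \<in> {1..p} \<and> b \<in> {1..p} \<and> a \<noteq> b \<and> \<bar>a - b\<bar> \<le> 2"
  by (auto simp: straight_linear_2_tree_def doubleton_eq_iff)

lemma Union_E: "\<Union>(E p) \<subseteq> {1..p}"
  by (auto simp: straight_linear_2_tree_def)

lemma finite_E: "finite (E p)"
proof (rule finite_subset)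
  show "E p \<subseteq> Pow {1..p}" by (auto simp: straight_linear_2_tree_def)
qed simp

lemma equiv_upto_conn:
  assumes "A \<subseteq> E p"
  shows "equiv_upto p (conn A)"
proof -
  have "\<Union>A \<subseteq> {1..p}" using Union_mono [OF assms] Union_E by (rule order_trans)
  then have "x \<notin> \<Union>A" if "p < x" for x using that by (meson atLeastAtMost_iff linorder_not_le subsetD)
  then show ?thesis by (simp add: equiv_upto_def equivp_conn conn_isolated)
qed

lemma equiv_upto_link:
  assumes "equiv_upto p R" "a \<le> p" "b \<le> p"
  shows "equiv_upto p (link a b R)"
  unfolding equiv_upto_def
proof (intro conjI equivpI reflpI sympI transpI allI impI)
  note R = equiv_uptoD [OF assms(1)]
  show "link a b R u u" for u by (simp add: link_def R(1))
  show "link a b R v u" if "link a b R u v" for u v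
    using that R(2) unfolding link_def by blast
  show "link a b R u w" if "link a b R u v" "link a b R v w" for u v w
    using that R(2,3) unfolding link_def by meson
  show "link a b R x v \<longleftrightarrow> v = x" if "p < x" for x v
    using that assms(2,3) by (auto simp: link_def R(4,5))
qed

lemma num_cong:
  assumes "\<And>R. equiv_upto p R \<Longrightarrow> P R \<longleftrightarrow> Q R"
  shows "num p P = num p Q"
  unfolding num_def using assms equiv_upto_conn by (metis (no_types, lifting))

lemma num_False:
  assumes "\<And>R. equiv_upto p R \<Longrightarrow> \<not> P R"
  shows "num p P = 0"
proof -
  have "num p P = num p (\<lambda>_. False)" using assms by (intro num_cong) blast
  then show ?thesis by (simp add: num_def)
qed

section \<open>Recursion on the last vertex\<close>

lemma card_subsets_insert:
  assumes "finite B" "e \<notin> B"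
  shows "card {A. A \<subseteq> insert e B \<and> P A}
    = card {A. A \<subseteq> B \<and> P A} + card {A. A \<subseteq> B \<and> P (insert e A)}"
proof -
  have "{A. A \<subseteq> insert e B \<and> P A}
    = {A. A \<subseteq> B \<and> P A} \<union> insert e ` {A. A \<subseteq> B \<and> P (insert e A)}"
    (is "?X = ?Y \<union> insert e ` ?Z")
  proof (intro equalityI subsetI)
    fix A
    assume A: "A \<in> ?X"
    show "A \<in> ?Y \<union> insert e ` ?Z"
    proof (cases "e \<in> A")
      case True
      then have "A = insert e (A - {e})" by blast
      then show ?thesis using A by (intro UnI2 image_eqI [of _ _ "A - {e}"]) auto
    qed (use A in auto)
  qed auto
  moreover have "inj_on (insert e) ?Z"
    using assms(2) by (intro inj_onI) (metis (no_types, lifting) insert_ident mem_Collect_eq subsetD)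
  moreover have "?Y \<inter> insert e ` ?Z = {}" using assms(2) by auto
  moreover have "finite ?Y" "finite ?Z" using assms(1) by auto
  ultimately show ?thesis by (simp add: card_Un_disjoint card_image)
qed

lemma E_Suc:
  assumes "2 \<le> p"
  shows "E (p + 1) = insert {p - 1, p + 1} (insert {p, p + 1} (E p))"
proof (intro equalityI subsetI)
  fix e
  assume e: "e \<in> E (p + 1)"
  then obtain a b where "e = {a, b}" "a < b" "b \<le> p + 1" "1 \<le> a" "b - a \<le> 2"
    by (auto simp: straight_linear_2_tree_def insert_commute neq_iff abs_if split: if_splits)
  moreover from this have "b = p + 1 \<and> a = p - 1 \<or> b = p + 1 \<and> a = p \<or> b \<le> p" by linarith
  ultimately show "e \<in> insert {p - 1, p + 1} (insert {p, p + 1} (E p))"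
    by (auto simp: in_E_iff)
next
  fix e
  assume "e \<in> insert {p - 1, p + 1} (insert {p, p + 1} (E p))"
  moreover have "E p \<subseteq> E (p + 1)" by (auto simp: straight_linear_2_tree_def) fastforce
  ultimately show "e \<in> E (p + 1)" using assms by (auto simp: in_E_iff)
qed

text \<open>One summand for each subset of the two new edges. A single one never closes a cycle
  because \<open>p + 1\<close> is isolated before; both together close one iff \<open>p - 1\<close>
  and \<open>p\<close> are already connected.\<close>

lemma num_Suc:
  assumes p: "2 \<le> p"
  shows "num (p + 1) P = num p P + num p (\<lambda>R. P (link (p - 1) (p + 1) R))
    + num p (\<lambda>R. P (link p (p + 1) R))
    + num p (\<lambda>R. \<not> R (p - 1) p \<and> P (link (p - 1) (p + 1) (link p (p + 1) R)))"
proof -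
  let ?e = "{p - 1, p + 1}" and ?f = "{p, p + 1}"
  have new: "?f \<notin> E p" "?e \<notin> insert ?f (E p)" by (auto simp: in_E_iff doubleton_eq_iff)
  have acyc_e: "acyc (insert ?e A) \<longleftrightarrow> acyc A"
    and acyc_f: "acyc (insert ?f A) \<longleftrightarrow> acyc A"
    and acyc_ef: "acyc (insert ?e (insert ?f A)) \<longleftrightarrow> acyc A \<and> \<not> conn A (p - 1) p"
    if A: "A \<subseteq> E p" for A
  proof -
    note R = equiv_uptoD [OF equiv_upto_conn [OF A]]
    have ef: "?f \<notin> A" "?e \<notin> A" "?e \<notin> insert ?f A" using A new by auto
    show "acyc (insert ?e A) \<longleftrightarrow> acyc A" "acyc (insert ?f A) \<longleftrightarrow> acyc A"
      using ef by (simp_all add: acyc_insert R(5))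
    then show "acyc (insert ?e (insert ?f A)) \<longleftrightarrow> acyc A \<and> \<not> conn A (p - 1) p"
      using ef by (simp add: acyc_insert conn_insert link_def R(1,4,5))
  qed
  show ?thesis
    unfolding num_def E_Suc [OF p]
    using finite_E [of p]
    by (simp add: card_subsets_insert [OF _ new(1)]
        card_subsets_insert [OF _ new(2), where P = "\<lambda>A. acyc A \<and> P (conn A)"]
        acyc_e acyc_f acyc_ef conn_insert cong: conj_cong)
qed

text \<open>The new vertex connects \<open>a\<close> with \<open>b\<close>, and once these are
  merged it is just a leaf. Hence the order of the two edges does not matter.\<close>

lemma link_link:
  assumes "equiv_upto p R" "a \<le> p" "b \<le> p"
  shows "link a (p + 1) (link b (p + 1) R) = link b (p + 1) (link a b R)"
    and "link b (p + 1) (link a (p + 1) R) = link b (p + 1) (link a b R)"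
proof -
  note R = equiv_uptoD [OF assms(1)]
  have [simp]: "R (p + 1) v \<longleftrightarrow> v = p + 1" "R v (p + 1) \<longleftrightarrow> v = p + 1" for v
    by (simp_all add: R(4,5))
  have [simp]: "R u u" for u by (rule R)
  have [simp]: "a \<noteq> p + 1" "b \<noteq> p + 1" "p + 1 \<noteq> a" "p + 1 \<noteq> b" using assms by auto
  have eqs: "link a (p + 1) (link b (p + 1) R) u v \<longleftrightarrow> link b (p + 1) (link a b R) u v"
    "link b (p + 1) (link a (p + 1) R) u v \<longleftrightarrow> link b (p + 1) (link a b R) u v" for u v
  proof -
    have rules: "R a b \<Longrightarrow> R b a" "R b a \<Longrightarrow> R a b"
      "R u a \<Longrightarrow> R a b \<Longrightarrow> R u b" "R u b \<Longrightarrow> R b a \<Longrightarrow> R u a"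
      "R a b \<Longrightarrow> R b v \<Longrightarrow> R a v" "R b a \<Longrightarrow> R a v \<Longrightarrow> R b v"
      "R u a \<Longrightarrow> R a v \<Longrightarrow> R u v" "R u b \<Longrightarrow> R b v \<Longrightarrow> R u v"
      by (fact R(2,3))+
    show "link a (p + 1) (link b (p + 1) R) u v \<longleftrightarrow> link b (p + 1) (link a b R) u v"
      "link b (p + 1) (link a (p + 1) R) u v \<longleftrightarrow> link b (p + 1) (link a b R) u v"
      by (cases "u = p + 1"; cases "v = p + 1"; simp add: link_def; use rules in blast)+
  qed
  show "link a (p + 1) (link b (p + 1) R) = link b (p + 1) (link a b R)"
    "link b (p + 1) (link a (p + 1) R) = link b (p + 1) (link a b R)"
    by (intro ext eqs)+
qed

text \<open>With \<open>U = num p (Q p)\<close> and \<open>V = num p (glued Q p)\<close>, the four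
  summands of \<open>num_Suc\<close> are 0, U, U, V for the first equation and U, V, 0, 0 for the
  second. The last two vanish since \<open>p\<close> and \<open>p + 1\<close> are then adjacent and
  cannot be glued.\<close>

lemma num_leaf_invariant_Suc:
  assumes p: "2 \<le> p" and Q: "leaf_invariant p Q"
  shows "num (p + 1) (Q (p + 1)) = 2 * num p (Q p) + num p (glued Q p)"
    and "num (p + 1) (glued Q (p + 1)) = num p (Q p) + num p (glued Q p)"
proof -
  have iso: "\<not> Q (p + 1) R" and leaf: "a \<in> {1..p} \<Longrightarrow> Q (p + 1) (link a (p + 1) R) \<longleftrightarrow> Q p R"
    if "equiv_upto p R" for R a
    using Q that by (auto simp: leaf_invariant_def)
  have both: "Q (p + 1) (link p (p + 1) (link (p - 1) p R)) \<longleftrightarrow> Q p (link (p - 1) p R)"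
    if "equiv_upto p R" for R
    using p leaf [OF equiv_upto_link [OF that]] by simp
  have "num p (Q (p + 1)) = 0" using iso by (rule num_False)
  moreover have "num p (\<lambda>R. Q (p + 1) (link (p - 1) (p + 1) R)) = num p (Q p)"
    "num p (\<lambda>R. Q (p + 1) (link p (p + 1) R)) = num p (Q p)"
    using leaf p by (auto intro!: num_cong)
  moreover have "num p (\<lambda>R. \<not> R (p - 1) p
      \<and> Q (p + 1) (link (p - 1) (p + 1) (link p (p + 1) R))) = num p (glued Q p)"
    using both by (intro num_cong) (simp add: link_link glued_def)
  ultimately show "num (p + 1) (Q (p + 1)) = 2 * num p (Q p) + num p (glued Q p)"
    by (simp add: num_Suc [OF p])
  have "num p (glued Q (p + 1)) = num p (Q p)"
  proof (rule num_cong)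
    fix R
    assume R: "equiv_upto p R"
    show "glued Q (p + 1) R \<longleftrightarrow> Q p R"
      using leaf [OF R] p by (simp add: glued_def equiv_uptoD(5) [OF R])
  qed
  moreover have "num p (\<lambda>R. glued Q (p + 1) (link (p - 1) (p + 1) R)) = num p (glued Q p)"
  proof (rule num_cong)
    fix R
    assume R: "equiv_upto p R"
    \<comment> \<open>As a leaf at \<open>p - 1\<close>, the new vertex stands for
      \<open>p - 1\<close>; gluing it to \<open>p\<close> amounts to gluing \<open>p - 1\<close> to
      \<open>p\<close>.\<close>
    have "link (p - 1) (p + 1) R p (p + 1) \<longleftrightarrow> R (p - 1) p"
      using equiv_uptoD(2) [OF R] by (auto simp: link_def equiv_uptoD(1,4,5) [OF R])
    moreover have "link p (p + 1) (link (p - 1) (p + 1) R) = link p (p + 1) (link (p - 1) p R)"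
      by (rule link_link(2) [OF R]) simp_all
    ultimately show "glued Q (p + 1) (link (p - 1) (p + 1) R) \<longleftrightarrow> glued Q p R"
      unfolding glued_def add_diff_cancel_right' using both [OF R] by simp
  qed
  moreover have "num p (\<lambda>R. glued Q (p + 1) (link p (p + 1) R)) = 0"
  proof (rule num_False)
    fix R
    assume R: "equiv_upto p R"
    show "\<not> glued Q (p + 1) (link p (p + 1) R)"
      by (simp add: glued_def link_def equiv_uptoD(1) [OF R])
  qed
  moreover have "num p (\<lambda>R. \<not> R (p - 1) p
      \<and> glued Q (p + 1) (link (p - 1) (p + 1) (link p (p + 1) R))) = 0"
  proof (rule num_False)
    fix R
    assume R: "equiv_upto p R"
    show "\<not> (\<not> R (p - 1) p \<and> glued Q (p + 1) (link (p - 1) (p + 1) (link p (p + 1) R)))"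
      by (simp add: glued_def link_def equiv_uptoD(1) [OF R])
  qed
  ultimately show "num (p + 1) (glued Q (p + 1)) = num p (Q p) + num p (glued Q p)"
    by (simp add: num_Suc [OF p])
qed

section \<open>Spanning trees and separating forests as instances\<close>

lemma ball_atLeastAtMost_Suc:
  assumes "1 \<le> p"
  shows "(\<forall>v\<in>{1..p + 1 :: int}. P v) \<longleftrightarrow> P (p + 1) \<and> (\<forall>v\<in>{1..p}. P v)"
proof -
  have "{1..p + 1} = insert (p + 1) {1..p}" using assms by auto
  then show ?thesis by simp
qed

lemma link_Suc:
  assumes "equiv_upto p R" "a \<le> p" "u \<le> p" "v \<le> p"
  shows "link a (p + 1) R u v \<longleftrightarrow> R u v" "link a (p + 1) R u (p + 1) \<longleftrightarrow> R u a"
    "link a (p + 1) R (p + 1) v \<longleftrightarrow> R a v" "link a (p + 1) R (p + 1) (p + 1)"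
  using assms(2-) by (auto simp: link_def equiv_uptoD(1,4,5) [OF assms(1)])

lemma leaf_invariant_tree:
  assumes "1 \<le> p"
  shows "leaf_invariant p tree"
  unfolding leaf_invariant_def
proof (intro allI impI conjI ballI)
  fix R
  assume R: "equiv_upto p R"
  have "\<not> R (p + 1) p" by (simp add: equiv_uptoD(4) [OF R])
  then show "\<not> tree (p + 1) R" using assms unfolding tree_def by force
  fix a
  assume "a \<in> {1..p}"
  then show "tree (p + 1) (link a (p + 1) R) = tree p R"
    using assms by (auto simp: tree_def ball_atLeastAtMost_Suc link_Suc [OF R])
qed

lemma leaf_invariant_sep:
  assumes "j \<in> {1..p}" "w \<in> {1..p}"
  shows "leaf_invariant p (sep j w)"
  unfolding leaf_invariant_def
proof (intro allI impI conjI ballI)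
  fix R
  assume R: "equiv_upto p R"
  have "\<not> R (p + 1) j" "\<not> R (p + 1) w" using assms by (auto simp: equiv_uptoD(4) [OF R])
  then show "\<not> sep j w (p + 1) R" using assms unfolding sep_def by force
  fix a
  assume a: "a \<in> {1..p}"
  show "sep j w (p + 1) (link a (p + 1) R) = sep j w p R"
    using assms a by (auto simp: sep_def ball_atLeastAtMost_Suc link_Suc [OF R])
qed

lemma sep_link_Suc:
  assumes R: "equiv_upto p R" and "j \<in> {1..p}" "a \<in> {1..p}"
  shows "sep j (p + 1) (p + 1) (link a (p + 1) R) \<longleftrightarrow> sep j a p R"
  using assms(2,3) by (auto simp: sep_def ball_atLeastAtMost_Suc link_Suc [OF R])

text \<open>Here the new vertex is itself one of the two to be separated, so leaf invariance fails:
  isolated, it may form a component alone beside a spanning tree of the rest. As a leaf at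
  \<open>a\<close> it takes over the role of \<open>a\<close>.\<close>

lemma num_sep_last:
  assumes p: "2 \<le> p" and j: "j \<in> {1..p}"
  shows "num (p + 1) (sep j (p + 1) (p + 1)) = num p (tree p)
    + num p (sep j (p - 1) p) + num p (sep j p p) + num p (glued (sep j p) p)"
proof -
  have "num p (sep j (p + 1) (p + 1)) = num p (tree p)"
  proof (rule num_cong)
    fix R
    assume R: "equiv_upto p R"
    have "sep j (p + 1) (p + 1) R \<longleftrightarrow> (\<forall>v\<in>{1..p}. R v j)"
      using j by (auto simp: sep_def ball_atLeastAtMost_Suc equiv_uptoD(1,4,5) [OF R])
    also have "\<dots> \<longleftrightarrow> tree p R"
      using j equiv_uptoD(2,3) [OF R] unfolding tree_def by blast
    finally show "sep j (p + 1) (p + 1) R \<longleftrightarrow> tree p R" .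
  qed
  moreover have "num p (\<lambda>R. sep j (p + 1) (p + 1) (link (p - 1) (p + 1) R))
      = num p (sep j (p - 1) p)"
    "num p (\<lambda>R. sep j (p + 1) (p + 1) (link p (p + 1) R)) = num p (sep j p p)"
    using p j by (auto simp: sep_link_Suc intro!: num_cong)
  moreover have "num p (\<lambda>R. \<not> R (p - 1) p
      \<and> sep j (p + 1) (p + 1) (link (p - 1) (p + 1) (link p (p + 1) R)))
      = num p (glued (sep j p) p)"
    using p j sep_link_Suc [OF equiv_upto_link]
    by (intro num_cong) (simp add: link_link glued_def)
  ultimately show ?thesis by (simp add: num_Suc [OF p])
qed

text \<open>Once \<open>p - 1\<close> and \<open>p\<close> are identified, it is the same to
  separate \<open>j\<close> from either of them.\<close>

lemma num_glued_sep_last: "num p (glued (sep j p) p) = num p (glued (sep j (p - 1)) p)"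
proof (rule num_cong)
  fix R
  assume R: "equiv_upto p R"
  have "link (p - 1) p R u p \<longleftrightarrow> link (p - 1) p R u (p - 1)" for u
    by (auto simp: link_def equiv_uptoD(1) [OF R])
  then show "glued (sep j p) p R \<longleftrightarrow> glued (sep j (p - 1)) p R"
    by (simp add: glued_def sep_def)
qed

lemma num_sep_refl: "num p (sep j j p) = 0"
  by (rule num_False) (auto simp: sep_def dest: equiv_uptoD(1))

text \<open>Identifying one vertex from each of the two components merges them into a single one;
  conversely, undoing the identification leaves every vertex connected to \<open>j\<close> or
  \<open>j + 1\<close>.\<close>

lemma num_sep_adjacent:
  assumes "1 \<le> j"
  shows "num (j + 1) (sep j (j + 1) (j + 1)) = num (j + 1) (glued tree (j + 1))"
proof (rule num_cong)
  fix R
  assume R: "equiv_upto (j + 1) R"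
  show "sep j (j + 1) (j + 1) R \<longleftrightarrow> glued tree (j + 1) R"
  proof
    assume sep: "sep j (j + 1) (j + 1) R"
    have "link j (j + 1) R u v" if "u \<in> {1..j + 1}" "v \<in> {1..j + 1}" for u v
    proof -
      have "R u j \<or> R u (j + 1)" "R j v \<or> R (j + 1) v"
        using sep that equiv_uptoD(2) [OF R] unfolding sep_def by blast+
      then show ?thesis
        using equiv_uptoD(3) [OF R] unfolding link_def by blast
    qed
    then show "glued tree (j + 1) R" using sep by (simp add: sep_def glued_def tree_def)
  next
    assume t: "glued tree (j + 1) R"
    then have "link j (j + 1) R v j" if "v \<in> {1..j + 1}" for v
      using assms that unfolding glued_def tree_def by simp
    moreover have "\<not> R j (j + 1)" using t by (simp add: glued_def)
    moreover have "\<not> R (j + 1) j" using calculation(2) equiv_uptoD(2) [OF R, of "j + 1" j] by blast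
    ultimately show "sep j (j + 1) (j + 1) R" unfolding sep_def link_def by blast
  qed
qed

text \<open>Initial values: the single edge is the spanning tree, and the empty edge set becomes one
  after gluing.\<close>

lemma num_2: "num 2 (tree 2) = 1" "num 2 (glued tree 2) = 1"
proof -
  have E: "E 2 = insert {1, 2} {}"
  proof
    show "E 2 \<subseteq> insert {1, 2} {}"
    proof
      fix e
      assume "e \<in> E 2"
      then obtain a b where "e = {a, b}" "a \<in> {1..2}" "b \<in> {1..2}" "a \<noteq> b"
        by (auto simp: straight_linear_2_tree_def)
      moreover have "a = 1 \<and> b = 2 \<or> a = 2 \<and> b = 1"
        using calculation(2-4) by auto
      ultimately show "e \<in> insert {1, 2} {}" by auto
    qed
  qed (simp add: in_E_iff)
  have "{1..2} = {1, 2 :: int}" by auto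
  moreover have "conn {} u v \<longleftrightarrow> v = u" for u v :: int by (simp add: conn_isolated)
  moreover have "acyc {{1, 2 :: int}}" by (simp add: acyc_insert acyc_empty calculation(2))
  ultimately show "num 2 (tree 2) = 1" "num 2 (glued tree 2) = 1"
    unfolding num_def E
    by (simp_all add: card_subsets_insert acyc_empty conn_insert tree_def glued_def link_def
        cong: conj_cong)
qed

section \<open>Spanning 2-forests as acyclic edge sets\<close>

lemma component_eq_iff:
  assumes "simple_graph H" "u \<in> verts H" "v \<in> verts H"
  shows "component H u = component H v \<longleftrightarrow> conn (edges H) u v"
proof
  assume "component H u = component H v"
  then show "conn (edges H) u v"
    using assms by (auto simp: component_eq_conn set_eq_iff)
next
  assume "conn (edges H) u v"
  then show "component H u = component H v"
    using assms by (auto simp: component_eq_conn intro: conn_sym conn_trans)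
qed

lemma two_components_iff:
  assumes H: "simple_graph H" and jw: "j \<in> verts H" "w \<in> verts H"
  shows "card (components H) = 2 \<and> separates H j w \<longleftrightarrow>
    \<not> conn (edges H) j w \<and> (\<forall>v\<in>verts H. conn (edges H) v j \<or> conn (edges H) v w)"
proof
  assume *: "card (components H) = 2 \<and> separates H j w"
  then have ne: "component H j \<noteq> component H w" by (simp add: separates_def)
  have sub: "{component H j, component H w} \<subseteq> components H" using jw by (simp add: components_def)
  have "finite (components H)" using * by (intro card_ge_0_finite) simp
  then have "components H = {component H j, component H w}"
    using sub ne * by (intro card_subset_eq [symmetric]) auto
  then have "component H v = component H j \<or> component H v = component H w" if "v \<in> verts H" for v
    using that by (auto simp: components_def)
  then show "\<not> conn (edges H) j w \<and> (\<forall>v\<in>verts H. conn (edges H) v j \<or> conn (edges H) v w)"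
    using ne jw by (simp add: component_eq_iff [OF H])
next
  assume *: "\<not> conn (edges H) j w \<and> (\<forall>v\<in>verts H. conn (edges H) v j \<or> conn (edges H) v w)"
  have ne: "component H j \<noteq> component H w" using * jw by (simp add: component_eq_iff [OF H])
  have "component H v \<in> {component H j, component H w}" if "v \<in> verts H" for v
    using * jw that by (simp add: component_eq_iff [OF H])
  then have "components H = {component H j, component H w}"
    using jw by (auto simp: components_def)
  then show "card (components H) = 2 \<and> separates H j w" using ne by (simp add: separates_def)
qed

text \<open>A spanning subgraph is determined by its edge set, so \<open>?g\<close> is a bijection
  from the edge sets counted by \<open>num\<close> to the forests in question.\<close>

lemma card_separating_2_forests:
  assumes "j \<in> {1..n}" "w \<in> {1..n}"
  shows "int (card {H. spanning_2_forest H (straight_linear_2_tree n) \<and> separates H j w})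
    = num n (sep j w n)"
proof -
  let ?G = "straight_linear_2_tree n" and ?g = "\<lambda>A. \<lparr>verts = {1..n}, edges = A\<rparr>"
  have good: "spanning_2_forest (?g A) ?G \<and> separates (?g A) j w \<longleftrightarrow>
      A \<subseteq> E n \<and> acyc A \<and> sep j w n (conn A)" for A
  proof (cases "A \<subseteq> E n")
    case True
    then have "\<exists>u\<in>{1..n}. \<exists>v\<in>{1..n}. u \<noteq> v \<and> e = {u, v}" if "e \<in> A" for e
      using that simple_graph_straight_linear_2_tree [of n]
      unfolding simple_graph_def by (simp add: straight_linear_2_tree_def subset_iff)
    then have H: "simple_graph (?g A)" by (simp add: simple_graph_def)
    then have "spanning_subgraph (?g A) ?G"
      using True by (simp add: spanning_subgraph_def straight_linear_2_tree_def)
    then show ?thesis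
      using True two_components_iff [OF H] assms forest_iff_acyc [OF H]
      by (auto simp: spanning_2_forest_def sep_def)
  qed (simp add: spanning_2_forest_def spanning_subgraph_def)
  have "{H. spanning_2_forest H ?G \<and> separates H j w}
    = ?g ` {A. A \<subseteq> E n \<and> acyc A \<and> sep j w n (conn A)}"
  proof (intro equalityI subsetI)
    fix H
    assume H: "H \<in> {H. spanning_2_forest H ?G \<and> separates H j w}"
    then have "verts H = {1..n}"
      by (simp add: spanning_2_forest_def spanning_subgraph_def straight_linear_2_tree_def)
    then have "H = ?g (edges H)" by simp
    then show "H \<in> ?g ` {A. A \<subseteq> E n \<and> acyc A \<and> sep j w n (conn A)}"
      using H good [of "edges H"] by auto
  qed (use good in auto)
  moreover have "inj ?g" by (intro injI) simp
  ultimately show ?thesis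
    by (simp add: num_def card_image inj_on_subset)
qed

section \<open>Fibonacci identities\<close>

lemma fibz_rec2: "fibz (p + 2) = fibz (p + 1) + fibz p"
  using fibz_rec [of "p + 1"] by (simp add: add.commute)

text \<open>Two consecutive instances are proved together, since the recurrence has order two; the
  induction runs in both directions and so covers negative indices.\<close>

lemma fibz_add: "fibz (u + v) = fibz u * fibz (v + 1) + fibz (u - 1) * fibz v"
proof -
  have "fibz (u + v) = fibz u * fibz (v + 1) + fibz (u - 1) * fibz v \<and>
    fibz (u + v + 1) = fibz (u + 1) * fibz (v + 1) + fibz u * fibz v"
  proof (induction u rule: int_induct [where k = 0])
    case base
    then show ?case using fibz_rec [of 0] by simp
  next
    case (step1 i)
    then show ?case
      using fibz_rec [of "i + 1"] fibz_rec [of i] fibz_rec [of "i + v + 1"]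
      by (simp add: algebra_simps)
  next
    case (step2 i)
    then show ?case
      using fibz_rec [of "i - 1"] fibz_rec [of i] fibz_rec [of "i + v"]
      by (simp add: algebra_simps)
  qed
  then show ?thesis ..
qed

text \<open>This quadratic form is 1 at \<open>d = 0\<close> and changes its sign whenever
  \<open>d\<close> moves by one.\<close>

lemma fibz_cassini_even:
  assumes "even d"
  shows "(fibz (d + 1))\<^sup>2 - fibz (d + 1) * fibz d - (fibz d)\<^sup>2 = 1"
proof -
  have "(fibz (d + 1))\<^sup>2 - fibz (d + 1) * fibz d - (fibz d)\<^sup>2 = (if even d then 1 else -1)"
  proof (induction d rule: int_induct [where k = 0])
    case base
    then show ?case by simp
  next
    case (step1 i)
    then show ?case
      using fibz_rec [of "i + 1"] by (auto simp: power2_eq_square algebra_simps split: if_splits)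
  next
    case (step2 i)
    then show ?case
      using fibz_rec [of i] by (auto simp: power2_eq_square algebra_simps split: if_splits)
  qed
  then show ?thesis using assms by simp
qed

lemma sum_atLeastAtMost_int_Suc:
  fixes f :: "int \<Rightarrow> int"
  assumes "0 \<le> k"
  shows "(\<Sum>i = 1..k + 1. f i) = (\<Sum>i = 1..k. f i) + f (k + 1)"
proof -
  have "{1..k + 1} = insert (k + 1) {1..k}" using assms by auto
  then show ?thesis by simp
qed

text \<open>The factor 5 keeps the identity within the integers. By induction on \<open>k\<close>,
  it is enough that the right-hand side grows by five times the next summand.\<close>

lemma closed_form:
  fixes m j k :: int
  assumes "0 \<le> k"
  shows "5 * (\<Sum>i = 1..k. (fibz i * fibz (i + 2*j - 2) - fibz (i - 1) * fibz (i + 2*j - 3))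
                     * fibz (2*m - 2*i - 2*j + 5))
       = 5 * ((fibz (m + 1))\<^sup>2 + (fibz k)\<^sup>2 * (fibz (m - 2*j - k + 3))\<^sup>2)
         + fibz (m + 1) * (fibz (m - k) * (k * lucas k - fibz k)
               + fibz (m - k + 1) * ((k - 5) * fibz (k + 1) + (2*k + 2) * fibz k))"
    (is "5 * (\<Sum>i = 1..k. ?t i) = ?r k")
  using assms
proof (induction k rule: int_ge_induct)
  case base
  \<comment> \<open>At \<open>k = 0\<close> the term with coefficient \<open>k - 5\<close> cancels
    \<open>5 * (fibz (m + 1))\<^sup>2\<close>.\<close>
  then show ?case by (simp add: power2_eq_square)
next
  case (step k)
  \<comment> \<open>Chosen so that \<open>d + c = m - k\<close>. Every index that occurs is then a
    sum of \<open>k\<close>, \<open>c\<close>, \<open>d\<close> and small constants, and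
    \<open>fibz_add\<close> reduces all values to the six numbers below. \<open>d\<close> is even,
    as the Cassini identity requires.\<close>
  define c d where "c = m - 2*j - k + 2" and "d = 2*j - 2"
  define x y a b p q where
    "x = fibz k" and "y = fibz (k + 1)" and "a = fibz c" and "b = fibz (c + 1)"
    and "p = fibz d" and "q = fibz (d + 1)"
  note basis = x_def [symmetric] y_def [symmetric] a_def [symmetric] b_def [symmetric]
    p_def [symmetric] q_def [symmetric]
  define g h where "g = p * b + (q - p) * a" and "h = q * b + p * a"
  have low: "fibz (k - 1) = y - x" "fibz (k + 2) = x + y" "fibz (d - 1) = q - p"
    using fibz_rec [of k] fibz_rec2 [of k] fibz_rec [of d] by (simp_all add: basis)
  have g: "fibz (d + c) = g" and "fibz (d + 1 + c) = h"
    using fibz_add [of d c] fibz_add [of "d + 1" c]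
    by (simp_all add: basis low g_def h_def)
  then have h: "fibz (d + c + 1) = h" by (simp add: ac_simps)
  have h1: "fibz (d + c - 1) = h - g"
    using fibz_rec [of "d + c"] g h by (simp add: algebra_simps)
  have M: "fibz (k + 1 + (d + c)) = y * h + x * g"
    using fibz_add [of "k + 1" "d + c"] by (simp add: basis g h)
  have t1: "fibz (k + 1 + d) = y * q + x * p" and t2: "fibz (k + d) = x * q + (y - x) * p"
    using fibz_add [of "k + 1" d] fibz_add [of k d] by (simp_all add: basis low)
  have t3: "fibz (c + 1 + (d + c)) = b * h + a * g"
    using fibz_add [of "c + 1" "d + c"] by (simp add: basis g h)
  have L: "lucas k = 2 * y - x" "lucas (k + 1) = 2 * x + y"
    unfolding lucas_def by (simp_all add: low basis add.assoc)
  have N: "q\<^sup>2 - q * p - p\<^sup>2 = 1"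
    unfolding p_def q_def by (rule fibz_cassini_even) (simp add: d_def)
  have T: "?t (k + 1) = (y * (y * q + x * p) - x * (x * q + (y - x) * p)) * (b * h + a * g)"
  proof -
    have "k + 1 + 2*j - 2 = k + 1 + d" "k + 1 - 1 = k" "k + 1 + 2*j - 3 = k + d"
      "2*m - 2*(k + 1) - 2*j + 5 = c + 1 + (d + c)"
      by (simp_all add: c_def d_def)
    then show ?thesis by (simp only: t1 t2 t3 basis)
  qed
  have R1: "?r (k + 1) = 5 * ((y * h + x * g)\<^sup>2 + y\<^sup>2 * a\<^sup>2)
      + (y * h + x * g) * ((h - g) * ((k + 1) * (2 * x + y) - y)
        + g * ((k - 4) * (x + y) + (2 * k + 4) * y))"
  proof -
    have "m + 1 = k + 1 + (d + c)" "m - 2*j - (k + 1) + 3 = c" "m - (k + 1) = d + c - 1"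
      "m - (k + 1) + 1 = d + c" "k + 1 + 1 = k + 2" "k + 1 - 5 = k - 4" "2 * (k + 1) + 2 = 2 * k + 4"
      by (simp_all add: c_def d_def)
    then show ?thesis by (simp only: M h1 g basis L low)
  qed
  have R0: "?r k = 5 * ((y * h + x * g)\<^sup>2 + x\<^sup>2 * b\<^sup>2)
      + (y * h + x * g) * (g * (k * (2 * y - x) - x) + h * ((k - 5) * y + (2 * k + 2) * x))"
  proof -
    have "m + 1 = k + 1 + (d + c)" "m - 2*j - k + 3 = c + 1" "m - k = d + c"
      by (simp_all add: c_def d_def)
    then show ?thesis by (simp only: M g h basis L low)
  qed
  \<comment> \<open>The factor \<open>q\<^sup>2 - q * p - p\<^sup>2 = 1\<close> makes this homogeneous, hence an identity of polynomials.\<close>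
  have "5 * (y\<^sup>2 * a\<^sup>2 - x\<^sup>2 * b\<^sup>2) * (q\<^sup>2 - q * p - p\<^sup>2)
      + (y * h + x * g) * ((h - g) * ((k + 1) * (2 * x + y) - y)
        + g * ((k - 4) * (x + y) + (2 * k + 4) * y))
      - (y * h + x * g) * (g * (k * (2 * y - x) - x) + h * ((k - 5) * y + (2 * k + 2) * x))
    = 5 * ((y * (y * q + x * p) - x * (x * q + (y - x) * p)) * (b * h + a * g))"
    unfolding g_def h_def by algebra
  then have "?r (k + 1) - ?r k = 5 * ?t (k + 1)"
    unfolding R1 R0 T N by (simp add: distrib_left right_diff_distrib)
  then show ?case
    unfolding sum_atLeastAtMost_int_Suc [OF step.hyps] distrib_left step.IH by linarith
qed

section \<open>Solving the recurrences\<close>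

text \<open>The step matrix with rows (2, 1) and (1, 1) is the square of the Fibonacci matrix with
  rows (1, 1) and (1, 0), so each step advances the index by two.\<close>

lemma linear_recurrence_fibz:
  fixes f g :: "int \<Rightarrow> int"
  assumes step: "\<And>p. s \<le> p \<Longrightarrow> f (p + 1) = 2 * f p + g p"
    "\<And>p. s \<le> p \<Longrightarrow> g (p + 1) = f p + g p"
    and p: "s \<le> p"
  shows "f p = fibz (2 * (p - s) + 1) * f s + fibz (2 * (p - s)) * g s"
    and "g p = fibz (2 * (p - s)) * f s + fibz (2 * (p - s) - 1) * g s"
proof -
  have "f p = fibz (2 * (p - s) + 1) * f s + fibz (2 * (p - s)) * g s
    \<and> g p = fibz (2 * (p - s)) * f s + fibz (2 * (p - s) - 1) * g s"
    using p
  proof (induction p rule: int_ge_induct)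
    case base
    show ?case using fibz_rec [of 0] by simp
  next
    case (step p)
    define d where "d = 2 * (p - s)"
    have "2 * (p + 1 - s) = d + 2" by (simp add: d_def)
    moreover have "fibz (d + 2 + 1) = 2 * fibz (d + 1) + fibz d" "fibz (d + 2) = fibz (d + 1) + fibz d"
      "fibz (d + 2 - 1) = fibz d + fibz (d - 1)"
      using fibz_rec [of "d + 2"] fibz_rec2 [of d] fibz_rec [of d] by (simp_all add: algebra_simps)
    moreover have "f (p + 1) = 2 * f p + g p" "g (p + 1) = f p + g p"
      using assms(1,2) step.hyps by blast+
    ultimately show ?case
      using step.IH by (simp add: d_def [symmetric]) (simp add: algebra_simps)
  qed
  then show "f p = fibz (2 * (p - s) + 1) * f s + fibz (2 * (p - s)) * g s"
    and "g p = fibz (2 * (p - s)) * f s + fibz (2 * (p - s) - 1) * g s" by blast+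
qed

lemma num_tree:
  assumes "2 \<le> p"
  shows "num p (tree p) = fibz (2 * p - 2)" "num p (glued tree p) = fibz (2 * p - 3)"
proof -
  have rec: "num (q + 1) (tree (q + 1)) = 2 * num q (tree q) + num q (glued tree q)"
    "num (q + 1) (glued tree (q + 1)) = num q (tree q) + num q (glued tree q)" if "2 \<le> q" for q
    using that num_leaf_invariant_Suc [OF that leaf_invariant_tree] by simp_all
  note sol = linear_recurrence_fibz [of 2 "\<lambda>p. num p (tree p)" "\<lambda>p. num p (glued tree p)" p,
      OF rec assms]
  show "num p (tree p) = fibz (2 * p - 2)"
    using sol(1) fibz_rec2 [of "2 * p - 4"] by (simp add: num_2 algebra_simps)
  show "num p (glued tree p) = fibz (2 * p - 3)"
    using sol(2) fibz_rec2 [of "2 * p - 5"] by (simp add: num_2 algebra_simps)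
qed

lemma num_sep_Suc:
  assumes "2 \<le> p" "j \<in> {1..p}" "w \<in> {1..p}"
  shows "num (p + 1) (sep j w (p + 1)) = 2 * num p (sep j w p) + num p (glued (sep j w) p)"
    and "num (p + 1) (glued (sep j w) (p + 1)) = num p (sep j w p) + num p (glued (sep j w) p)"
  using num_leaf_invariant_Suc [OF assms(1) leaf_invariant_sep [OF assms(2,3)]] by simp_all

text \<open>Subtracting \<open>num_sep_Suc\<close> for \<open>w = p\<close> from
  \<open>num_sep_last\<close> cancels the glued terms and leaves the number of trees minus the
  previous difference.\<close>

lemma num_sep_diff_last:
  assumes j: "1 \<le> j" and "j + 1 \<le> p"
  shows "num p (sep j p p) - num p (sep j (p - 1) p)
    = fibz (p - j) * fibz (p + j - 2) - fibz (p - j - 1) * fibz (p + j - 3)"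
  using assms(2)
proof (induction p rule: int_ge_induct)
  case base
  show ?case
    using j num_sep_adjacent [OF j] num_tree(2) [of "j + 1"]
    by (simp add: num_sep_refl)
next
  case (step p)
  have "num (p + 1) (sep j (p + 1) (p + 1)) - num (p + 1) (sep j p (p + 1))
      = fibz (2 * p - 2) - (num p (sep j p p) - num p (sep j (p - 1) p))"
    using j step.hyps num_sep_last [of p j] num_sep_Suc(1) [of p j p] num_tree(1) [of p]
    by simp
  \<comment> \<open>The claimed value obeys the same recurrence: by \<open>fibz_add\<close>,
    \<open>fibz (2 * p - 2)\<close> is the sum of two consecutive values.\<close>
  moreover have "fibz (p - j + 1) * fibz (p + j - 1) - fibz (p - j) * fibz (p + j - 2)
      = fibz (2 * p - 2)
        - (fibz (p - j) * fibz (p + j - 2) - fibz (p - j - 1) * fibz (p + j - 3))"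
  proof -
    have "fibz (p - j + 1) = fibz (p - j) + fibz (p - j - 1)"
      by (rule fibz_rec)
    moreover have "fibz (p + j - 1) = fibz (p + j - 2) + fibz (p + j - 3)"
      using fibz_rec [of "p + j - 2"] by simp
    moreover have "fibz (2 * p - 2)
      = fibz (p - j) * fibz (p + j - 1) + fibz (p - j - 1) * fibz (p + j - 2)"
      using fibz_add [of "p - j" "p + j - 2"] by simp
    ultimately show ?thesis by (simp add: algebra_simps)
  qed
  ultimately show ?case using step.IH by (simp add: algebra_simps)
qed

text \<open>From \<open>p\<close> vertices on, the differences obey the linear recurrence
  themselves. By \<open>num_glued_sep_last\<close> the glued one starts at 0, so only one term of
  the solution survives.\<close>

lemma num_sep_diff:
  assumes "1 \<le> j" "j + 1 \<le> p" "p \<le> n"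
  shows "num n (sep j p n) - num n (sep j (p - 1) n)
    = (fibz (p - j) * fibz (p + j - 2) - fibz (p - j - 1) * fibz (p + j - 3))
      * fibz (2 * (n - p) + 1)"
proof -
  let ?f = "\<lambda>n. num n (sep j p n) - num n (sep j (p - 1) n)"
    and ?g = "\<lambda>n. num n (glued (sep j p) n) - num n (glued (sep j (p - 1)) n)"
  have "?f (q + 1) = 2 * ?f q + ?g q" "?g (q + 1) = ?f q + ?g q" if "p \<le> q" for q
    using assms that num_sep_Suc [of q j p] num_sep_Suc [of q j "p - 1"] by simp_all
  from linear_recurrence_fibz(1) [of p ?f ?g n, OF this assms(3)]
  show ?thesis
    using num_glued_sep_last [of p j] num_sep_diff_last [OF assms(1,2)] by simp
qed

lemma num_sep_sum:
  assumes "1 \<le> j" "0 \<le> k" "j + k \<le> n"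
  shows "num n (sep j (j + k) n)
    = (\<Sum>i = 1..k. (fibz i * fibz (i + 2*j - 2) - fibz (i - 1) * fibz (i + 2*j - 3))
        * fibz (2 * (n - j - i) + 1))"
  using assms(2,3)
proof (induction k rule: int_ge_induct)
  case base
  \<comment> \<open>The telescoping starts at \<open>w = j\<close>, where no forest
    qualifies.\<close>
  show ?case by (simp add: num_sep_refl)
next
  case (step k)
  have "num n (sep j (j + (k + 1)) n) - num n (sep j (j + k) n)
    = (fibz (k + 1) * fibz (k + 1 + 2*j - 2) - fibz (k + 1 - 1) * fibz (k + 1 + 2*j - 3))
      * fibz (2 * (n - j - (k + 1)) + 1)"
    using num_sep_diff [of j "j + (k + 1)" n] assms(1) step by (simp add: algebra_simps)
  then show ?case
    using step by (simp only: sum_atLeastAtMost_int_Suc)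
qed

theorem theorem5p2:
  fixes m n j k :: int
  assumes "n = m + 2" and "n \<ge> 3"
    and "1 \<le> j" and "j < n" and "k \<ge> 1" and "j + k \<le> n"
  shows "int (card {H. spanning_2_forest H (straight_linear_2_tree n) \<and> separates H j (j + k)})
       = (\<Sum>i = 1..k. (fibz i * fibz (i + 2*j - 2) - fibz (i - 1) * fibz (i + 2*j - 3))
                     * fibz (2*m - 2*i - 2*j + 5))
     \<and> real_of_int
         (\<Sum>i = 1..k. (fibz i * fibz (i + 2*j - 2) - fibz (i - 1) * fibz (i + 2*j - 3))
                     * fibz (2*m - 2*i - 2*j + 5))
       = real_of_int ((fibz (m + 1))\<^sup>2 + (fibz k)\<^sup>2 * (fibz (m - 2*j - k + 3))\<^sup>2)
         + real_of_int (fibz (m + 1)) / 5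
           * real_of_int (fibz (m - k) * (k * lucas k - fibz k)
               + fibz (m - k + 1) * ((k - 5) * fibz (k + 1) + (2*k + 2) * fibz k))"
    (is "?c = ?s \<and> real_of_int ?s = real_of_int ?u + real_of_int ?v / 5 * real_of_int ?w")
proof
  have "?c = num n (sep j (j + k) n)"
    using assms by (intro card_separating_2_forests) simp_all
  also have "\<dots> = (\<Sum>i = 1..k. (fibz i * fibz (i + 2*j - 2) - fibz (i - 1) * fibz (i + 2*j - 3))
      * fibz (2 * (n - j - i) + 1))"
    using assms by (intro num_sep_sum) simp_all
  also have "\<dots> = ?s"
  proof -
    have "2 * (n - j - i) + 1 = 2*m - 2*i - 2*j + 5" for i
      using assms(1) by simp
    then show ?thesis by (simp only:)
  qed
  finally show "?c = ?s" .
  have "5 * ?s = 5 * ?u + ?v * ?w"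
    by (rule closed_form) (use assms(5) in simp)
  from arg_cong [OF this, of real_of_int]
  have "5 * real_of_int ?s = 5 * real_of_int ?u + real_of_int ?v * real_of_int ?w"
    by (simp only: of_int_add of_int_mult of_int_numeral)
  moreover have "x = y + v / 5 * w" if "5 * x = 5 * y + v * w" for x y v w :: real
    using that by simp
  ultimately show "real_of_int ?s = real_of_int ?u + real_of_int ?v / 5 * real_of_int ?w"
    by blast
qed

end
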